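(* Let $\mathcal X=\{x_0,\dots,x_{N-1}\}$ be the Chebyshev nodes of first kind $x_m=\cos\left(\frac{(2m+1)\pi}{2N}\right)$, $m=0,\dots,N-1$, and let $w_{x_m}=\pi/N$. Then the diagonal entries $h_{x_m,x_m}$ of the hat matrix $\boldsymbol H=\boldsymbol F(\boldsymbol F^{\mathsf H}\boldsymbol W\boldsymbol F+\lambda\hat{\boldsymbol W})^{-1}\boldsymbol F^{\mathsf H}\boldsymbol W$ can be written as $$h_{x_m,x_m}=\frac{w_{x_m}}2\left(\frac{\sqrt{N/2}}{\gamma_{2N}(m)}\left[\boldsymbol C^{\mathrm I}_{2N+1}\boldsymbol b\right]_{2m+1}+\sum_{n=1}^{N-1}\frac1{\pi/2+\lambda\hat w_n}\right),\qquad m=0,\dots,N-1,$$ with $$\boldsymbol b=(b_0,\dots,b_{2N})^{\mathsf T}=\left(\frac{2\sqrt2}{\pi+\lambda\hat w_0},0,\frac1{\pi/2+\lambda\hat w_1},0,\dots,\frac1{\pi/2+\lambda\hat w_{N-1}},0,0\right)^{\mathsf T}.$$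
   Context: $N\in\mathbb N$, and $\lambda>0$ is the regularization parameter. $T_n(x)=\cos(n\arccos x)$, $n=0,\dots,N-1$, are the Chebyshev polynomials on $[-1,1]$, and $\boldsymbol F=[T_n(x)]_{x\in\mathcal X,\,n=0,\dots,N-1}$. $\boldsymbol W=\operatorname{diag}(w_x)_{x\in\mathcal X}$ is the spatial weight matrix and $\hat{\boldsymbol W}=\operatorname{diag}(\hat w_0,\dots,\hat w_{N-1})$ is the strictly positive weight matrix in frequency domain. $^{\mathsf H}$ denotes the conjugate transpose. For $K\in\mathbb N$ the discrete cosine transform of first kind is $$\boldsymbol C^{\mathrm I}_{K+1}=\sqrt{\tfrac2K}\left[\gamma_K(n)\gamma_K(m)\cos\left(\tfrac{nm\pi}{K}\right)\right]_{n,m=0}^{K},$$ with $\gamma_K(0)=\gamma_K(K)=\sqrt2/2$ and $\gamma_K(n)=1$ for $n=1,\dots,K-1$. Entries of vectors of length $2N+1$ are indexed by $0,\dots,2N$.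
   Formalization: The printed prefactor sqrt(N/2)/gamma_{2N}(m) is replaced by sqrt(N)/gamma_{2N}(2m+1); the two agree for m=0, but the printed formula fails in general for m>=1 (e.g. N=2, lambda=1, w-hat_0=pi, w-hat_1=pi/2, m=1, where h=1/2 but the printed right side is (1+1/sqrt 2)/4). *)

theory Defs
  imports
    "HOL-Analysis.Analysis"
    "Jordan_Normal_Form.Matrix"
    "Jordan_Normal_Form.Schur_Decomposition"
    "Jordan_Normal_Form.Gauss_Jordan_Elimination"
begin

text \<open>Matrix rows belonging to the node set are indexed by \<open>m < N\<close>, standing for the node
  \<open>x\<^sub>m\<close>; the nodes are pairwise distinct. All indices start at 0.\<close>

text \<open>Meaningful only for \<open>-1 \<le> x \<le> 1\<close>, where \<open>arccos\<close> is the usual inverse of \<open>cos\<close>.\<close>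

definition cheb_T :: "nat \<Rightarrow> real \<Rightarrow> real" where
  "cheb_T n x = cos (real n * arccos x)"

definition cheb_node :: "nat \<Rightarrow> nat \<Rightarrow> real" where
  "cheb_node N m = cos ((2 * real m + 1) * pi / (2 * real N))"

definition cheb_fourier_mat :: "nat \<Rightarrow> (nat \<Rightarrow> real) \<Rightarrow> nat \<Rightarrow> real mat" where
  "cheb_fourier_mat M x N = mat M N (\<lambda>(m, n). cheb_T n (x m))"

text \<open>\<open>mat_inverse\<close> returns \<open>None\<close> on a singular matrix, and \<open>the None\<close> is an unspecified
  value, so an entry of \<open>hat_matrix\<close> can only be computed once the regularized normal
  matrix is known to be invertible.\<close>

definition hat_matrix ::
  "'a :: conjugatable_field mat \<Rightarrow> 'a mat \<Rightarrow> 'a \<Rightarrow> 'a mat \<Rightarrow> 'a mat" where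
  "hat_matrix F W lam What =
     F * the (mat_inverse (mat_adjoint F * W * F + lam \<cdot>\<^sub>m What)) * mat_adjoint F * W"

definition dct_gamma :: "nat \<Rightarrow> nat \<Rightarrow> real" where
  "dct_gamma K n = (if n = 0 \<or> n = K then sqrt 2 / 2 else 1)"

text \<open>The transform of size \<open>K + 1\<close>.\<close>

definition dct1 :: "nat \<Rightarrow> real mat" where
  "dct1 K = sqrt (2 / real K) \<cdot>\<^sub>m
     mat (K + 1) (K + 1)
       (\<lambda>(n, m). dct_gamma K n * dct_gamma K m * cos (real n * real m * pi / real K))"

text \<open>To read a cosine sum off entry \<open>k\<close> of \<open>dct1 K *\<^sub>v b\<close>, one divides by
  \<open>sqrt (2 / K) * dct_gamma K k\<close>. For \<open>K = 2 * N\<close> and \<open>k = 2 * m + 1\<close> this means multiplying by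
  \<open>sqrt N / dct_gamma (2 * N) (2 * m + 1)\<close>. The prefactor
  \<open>sqrt (N / 2) / dct_gamma (2 * N) m\<close> agrees with it at \<open>m = 0\<close> only.\<close>

text \<open>The frequency \<open>n < N\<close> sits at position \<open>2n\<close>; all odd positions and the last position
  \<open>2N\<close> are zero.\<close>

definition coeff_vec :: "nat \<Rightarrow> real \<Rightarrow> (nat \<Rightarrow> real) \<Rightarrow> real vec" where
  "coeff_vec N lam what = vec (2 * N + 1)
     (\<lambda>i. if i = 0 then 2 * sqrt 2 / (pi + lam * what 0)
          else if even i \<and> i < 2 * N then 1 / (pi / 2 + lam * what (i div 2))
          else 0)"

end

theory Submission
  imports Defs
begin

text \<open>
  At the Chebyshev nodes \<open>x\<^sub>m = cos \<theta>\<^sub>m\<close> with \<open>\<theta>\<^sub>m = (2 m + 1) \<pi> / (2 N)\<close> the polynomial \<open>T\<^sub>n\<close>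
  takes the value \<open>cos (n \<theta>\<^sub>m)\<close>, and the sampled cosines are orthogonal over \<open>m < N\<close>
  (\<open>sum_cheb_T_mult_cheb_node\<close>): the products split into sums of \<open>cos (k \<theta>\<^sub>m)\<close>, and such a sum
  telescopes to zero once it is multiplied by the sine of half the step. Hence the regularized
  normal matrix is diagonal, with entries \<open>\<pi> + \<lambda> what 0\<close> at frequency \<open>0\<close> and
  \<open>\<pi> / 2 + \<lambda> what n\<close> at frequencies \<open>n \<ge> 1\<close>. All of them are positive, so it is inverted
  entrywise and a diagonal entry of the hat matrix becomes the sum of
  \<open>w\<^sub>m (cos (n \<theta>\<^sub>m))\<^sup>2 / d\<^sub>n\<close> over \<open>n\<close> (\<open>hat_matrix_diagonal_entry\<close>).

  Halving the angle through \<open>(cos t)\<^sup>2 = (1 + cos (2 t)) / 2\<close> separates, for \<open>n \<ge> 1\<close>, a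
  constant part, which is the explicit sum in the result, from a cosine sum in the angles
  \<open>2 n \<theta>\<^sub>m = (2 n) (2 m + 1) \<pi> / (2 N)\<close>. The latter is row \<open>2 m + 1\<close> of a cosine transform on
  the grid of mesh \<open>\<pi> / (2 N)\<close>, applied to coefficients that live on the even positions
  (\<open>dct1_coeff_vec_odd\<close>).
\<close>

section \<open>Discrete orthogonality of the Chebyshev polynomials\<close>

text \<open>With \<open>a = k \<pi> / (2 N)\<close>, multiplication by \<open>2 sin a\<close> turns the summand
  \<open>cos ((2 m + 1) a)\<close> into \<open>sin (2 (m + 1) a) - sin (2 m a)\<close>. The sum telescopes to
  \<open>sin (2 N a) = sin (k \<pi>) = 0\<close>, and the range of \<open>k\<close> is what makes \<open>sin a\<close> nonzero.\<close>

lemma sum_cos_odd_multiples_eq_0: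
  fixes k N :: nat
  assumes "0 < k" "k < 2 * N"
  shows "(\<Sum>m<N. cos (real k * ((2 * real m + 1) * pi / (2 * real N)))) = 0"
proof -
  define a where "a = real k * pi / (2 * real N)"
  have a: "0 < a" "a < pi"
    using assms by (auto simp: a_def field_simps)
  have "2 * sin a * cos (real k * ((2 * real m + 1) * pi / (2 * real N)))
      = sin (2 * real (Suc m) * a) - sin (2 * real m * a)" for m
  proof -
    have arg: "real k * ((2 * real m + 1) * pi / (2 * real N)) = (2 * real m + 1) * a"
      by (simp add: a_def)
    have "(2 * real m + 1) * a + a = 2 * real (Suc m) * a"
      "(2 * real m + 1) * a - a = 2 * real m * a"
      by (simp_all add: algebra_simps)
    then show ?thesis
      unfolding arg using cos_times_sin[of "(2 * real m + 1) * a" a] by (simp add: mult_ac)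
  qed
  then have "2 * sin a * (\<Sum>m<N. cos (real k * ((2 * real m + 1) * pi / (2 * real N))))
      = (\<Sum>m<N. sin (2 * real (Suc m) * a) - sin (2 * real m * a))"
    unfolding sum_distrib_left by simp
  also have "\<dots> = sin (2 * real N * a) - sin (2 * real 0 * a)"
    by (rule sum_lessThan_telescope)
  also have "2 * real N * a = real k * pi"
    using assms by (simp add: a_def)
  finally show ?thesis
    using sin_gt_zero[OF a] by simp
qed

lemma cheb_T_cheb_node:
  assumes "m < N"
  shows "cheb_T n (cheb_node N m) = cos (real n * ((2 * real m + 1) * pi / (2 * real N)))"
proof -
  have "(2 * real m + 1) * pi \<le> (2 * real N) * pi"
    using assms by (intro mult_right_mono) auto
  then have "(2 * real m + 1) * pi / (2 * real N) \<le> pi"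
    using assms by (simp add: field_simps)
  then show ?thesis
    by (simp add: cheb_T_def cheb_node_def arccos_cos)
qed

text \<open>The product formula leaves the frequencies \<open>\<bar>i - j\<bar>\<close> and \<open>i + j\<close>. Both are below \<open>2 N\<close>,
  so each contributes only if it vanishes; for \<open>i = j = 0\<close> both do, which doubles the norm of
  \<open>T\<^sub>0\<close>.\<close>

lemma sum_cheb_T_mult_cheb_node:
  assumes "i < N" "j < N"
  shows "(\<Sum>m<N. cheb_T i (cheb_node N m) * cheb_T j (cheb_node N m))
    = (if i = j then if i = 0 then real N else real N / 2 else 0)"
proof -
  define S where "S k = (\<Sum>m<N. cos (real k * ((2 * real m + 1) * pi / (2 * real N))))" for k
  have S: "S k = (if k = 0 then real N else 0)" if "k < 2 * N" for k
    using sum_cos_odd_multiples_eq_0[of k N] that by (simp add: S_def)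
  define d where "d = (if j \<le> i then i - j else j - i)"
  have "cheb_T i (cheb_node N m) * cheb_T j (cheb_node N m)
      = (cos (real d * ((2 * real m + 1) * pi / (2 * real N)))
        + cos (real (i + j) * ((2 * real m + 1) * pi / (2 * real N)))) / 2" if "m < N" for m
  proof -
    define t where "t = (2 * real m + 1) * pi / (2 * real N)"
    have "cos (real i * t - real j * t) = cos (real d * t)"
    proof (cases "j \<le> i")
      case True
      then show ?thesis by (simp add: d_def of_nat_diff algebra_simps)
    next
      case False
      then have "real i * t - real j * t = - (real d * t)"
        by (simp add: d_def of_nat_diff algebra_simps)
      then show ?thesis by (simp only: cos_minus)
    qed
    moreover have "real i * t + real j * t = real (i + j) * t"
      by (simp add: algebra_simps)
    ultimately show ?thesis
      unfolding cheb_T_cheb_node[OF that] t_def[symmetric] cos_times_cos by simp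
  qed
  then have "(\<Sum>m<N. cheb_T i (cheb_node N m) * cheb_T j (cheb_node N m)) = (S d + S (i + j)) / 2"
    unfolding S_def sum.distrib[symmetric] sum_divide_distrib by (intro sum.cong) auto
  moreover have "d < 2 * N" "i + j < 2 * N" "d = 0 \<longleftrightarrow> i = j"
    using assms by (auto simp: d_def)
  ultimately show ?thesis
    by (auto simp: S)
qed

section \<open>Hat matrices with a diagonal normal matrix\<close>

lemma mat_adjoint_eq_mat:
  assumes "A \<in> carrier_mat nr nc"
  shows "mat_adjoint A = mat nc nr (\<lambda>(i, j). conjugate (A $$ (j, i)))"
  using assms by (intro eq_matI) (auto simp: mat_adjoint_def mat_of_rows_index)

text \<open>Uniqueness of the inverse identifies the result of the elimination: the entrywise
  reciprocal exhibits the matrix as a unit, which excludes \<open>None\<close>.\<close>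

lemma mat_inverse_mat_diag:
  fixes d :: "nat \<Rightarrow> 'a :: field"
  assumes "\<And>i. i < n \<Longrightarrow> d i \<noteq> 0"
  shows "mat_inverse (mat_diag n d) = Some (mat_diag n (\<lambda>i. 1 / d i))"
proof -
  let ?D = "mat_diag n d" and ?E = "mat_diag n (\<lambda>i. 1 / d i)"
  have DE: "?D * ?E = 1\<^sub>m n" and ED: "?E * ?D = 1\<^sub>m n"
    using assms unfolding mat_diag_diag by (auto simp: mat_diag_def)
  have D: "?D \<in> carrier_mat n n" and E: "?E \<in> carrier_mat n n"
    by simp_all
  have "?D \<in> Units (ring_mat TYPE('a) n ())"
    using D E DE ED unfolding Units_def ring_mat_def
    by (auto simp del: mat_diag_diag intro!: bexI[of _ ?E])
  then obtain B where B: "mat_inverse ?D = Some B"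
    using mat_inverse(1)[OF D, of "()"] by (cases "mat_inverse ?D") auto
  have BD: "B * ?D = 1\<^sub>m n" and Bc: "B \<in> carrier_mat n n"
    using mat_inverse(2)[OF D B] by auto
  have "B = B * (?D * ?E)"
    unfolding DE using Bc by simp
  also have "\<dots> = ?E"
    unfolding assoc_mult_mat[OF Bc D E, symmetric] BD by (rule left_mult_one_mat[OF E])
  finally show ?thesis
    using B by simp
qed

lemma hat_matrix_diagonal_entry:
  fixes F :: "'a :: conjugatable_field mat"
  assumes F: "F \<in> carrier_mat M N"
    and normal: "mat_adjoint F * mat_diag M w * F + lam \<cdot>\<^sub>m What = mat_diag N d"
    and d: "\<And>n. n < N \<Longrightarrow> d n \<noteq> 0"
    and m: "m < M"
  shows "hat_matrix F (mat_diag M w) lam What $$ (m, m)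
    = w m * (\<Sum>n<N. F $$ (m, n) * conjugate (F $$ (m, n)) / d n)"
proof -
  let ?FH = "mat N M (\<lambda>(i, j). conjugate (F $$ (j, i)))"
  let ?G = "mat M N (\<lambda>(i, j). F $$ (i, j) * (1 / d j))"
  have "hat_matrix F (mat_diag M w) lam What = ?G * ?FH * mat_diag M w"
    unfolding hat_matrix_def normal using d
    by (simp add: mat_inverse_mat_diag mat_diag_mult_right[OF F] mat_adjoint_eq_mat[OF F])
  also have "\<dots> = mat M M (\<lambda>(i, j). (?G * ?FH) $$ (i, j) * w j)"
    by (rule mat_diag_mult_right) auto
  finally show ?thesis
    using m by (simp add: scalar_prod_def lessThan_atLeast0 sum_distrib_left mult_ac)
qed

section \<open>The normal matrix at the Chebyshev nodes\<close>

lemma cheb_normal_matrix: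
  assumes x: "\<And>m. m < N \<Longrightarrow> x m = cheb_node N m"
    and w: "\<And>m. m < N \<Longrightarrow> w m = pi / real N"
  defines "F \<equiv> cheb_fourier_mat N x N"
  shows "mat_adjoint F * mat_diag N w * F + lam \<cdot>\<^sub>m mat_diag N what
    = mat_diag N (\<lambda>n. (if n = 0 then pi else pi / 2) + lam * what n)"
proof -
  have F: "F \<in> carrier_mat N N"
    by (simp add: F_def cheb_fourier_mat_def)
  have FH: "mat N N (\<lambda>(i, j). conjugate (F $$ (j, i))) \<in> carrier_mat N N"
    by simp
  have "(mat_adjoint F * mat_diag N w * F) $$ (i, j)
      = (if i = j then if i = 0 then pi else pi / 2 else 0)" if ij: "i < N" "j < N" for i j
  proof -
    have "(mat_adjoint F * mat_diag N w * F) $$ (i, j)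
        = (\<Sum>m<N. pi / real N * (cheb_T i (cheb_node N m) * cheb_T j (cheb_node N m)))"
      unfolding mat_adjoint_eq_mat[OF F] mat_diag_mult_right[OF FH] using ij F
      by (auto simp: scalar_prod_def lessThan_atLeast0 F_def cheb_fourier_mat_def x w mult_ac
          intro!: sum.cong)
    also have "\<dots> = pi / real N * (if i = j then if i = 0 then real N else real N / 2 else 0)"
      unfolding sum_distrib_left[symmetric] sum_cheb_T_mult_cheb_node[OF ij] ..
    finally show ?thesis
      using ij by auto
  qed
  then show ?thesis
    using F by (intro eq_matI) (auto simp: mat_diag_def mat_adjoint_eq_mat[OF F])
qed

section \<open>The cosine transform of the coefficient vector\<close>

text \<open>Only the even positions \<open>2 n\<close> with \<open>n < N\<close> survive, and the angle
  \<open>(2 m + 1) (2 n) \<pi> / (2 N)\<close> is twice \<open>n \<theta>\<^sub>m\<close>. The weight \<open>sqrt 2 / 2\<close> of position \<open>0\<close>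
  cancels against the factor \<open>sqrt 2\<close> of the zeroth coefficient. The odd index \<open>2 m + 1\<close> is
  never an endpoint of \<open>0..2 N\<close>, so its own weight is \<open>1\<close>.\<close>

lemma dct1_coeff_vec_odd:
  assumes m: "m < N"
  shows "sqrt (real N) / dct_gamma (2 * N) (2 * m + 1)
      * (dct1 (2 * N) *\<^sub>v coeff_vec N lam what) $ (2 * m + 1)
    = 2 / (pi + lam * what 0)
      + (\<Sum>n = 1..N - 1. cos (2 * (real n * ((2 * real m + 1) * pi / (2 * real N))))
          / (pi / 2 + lam * what n))"
proof -
  define t where "t = (2 * real m + 1) * pi / (2 * real N)"
  define b where "b = coeff_vec N lam what"
  define g where "g k = dct_gamma (2 * N) k * cos (real k * t) * b $ k" for k
  have gam: "dct_gamma (2 * N) (2 * m + 1) = 1"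
  proof -
    have "2 * m + 1 \<noteq> 2 * N" by presburger
    then show ?thesis by (simp add: dct_gamma_def)
  qed
  have "(dct1 (2 * N) *\<^sub>v b) $ (2 * m + 1)
      = (\<Sum>k<2 * N + 1. sqrt (2 / real (2 * N)) * g k)"
  proof -
    have arg: "real (2 * m + 1) * real k * pi / real (2 * N) = real k * t" for k
      by (simp add: t_def mult_ac)
    have "dim_vec b = 2 * N + 1"
      by (simp add: b_def coeff_vec_def)
    then have "(dct1 (2 * N) *\<^sub>v b) $ (2 * m + 1)
        = (\<Sum>k<2 * N + 1. sqrt (2 / real (2 * N)) * (dct_gamma (2 * N) (2 * m + 1)
          * dct_gamma (2 * N) k * cos (real (2 * m + 1) * real k * pi / real (2 * N))) * b $ k)"
      unfolding dct1_def using m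
      by (auto simp: scalar_prod_def lessThan_atLeast0 simp del: sum.op_ivl_Suc intro!: sum.cong)
    then show ?thesis
      unfolding arg gam by (simp only: g_def mult_ac mult_1_left mult_1_right)
  qed
  also have "\<dots> = sqrt (2 / real (2 * N)) * (\<Sum>k<2 * N + 1. g k)"
    by (rule sum_distrib_left[symmetric])
  also have "sqrt (2 / real (2 * N)) = 1 / sqrt (real N)"
    using m by (simp add: real_sqrt_divide)
  finally have "sqrt (real N) * (dct1 (2 * N) *\<^sub>v b) $ (2 * m + 1) = (\<Sum>k<2 * N + 1. g k)"
    using m by simp
  also have "\<dots> = (\<Sum>k\<in>(\<lambda>n. 2 * n) ` {..<N}. g k)"
  proof (rule sum.mono_neutral_right)
    show "\<forall>k\<in>{..<2 * N + 1} - (\<lambda>n. 2 * n) ` {..<N}. g k = 0"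
    proof
      fix k assume k: "k \<in> {..<2 * N + 1} - (\<lambda>n. 2 * n) ` {..<N}"
      then have "\<not> (even k \<and> k < 2 * N)" by (auto elim!: evenE)
      moreover from this k m have "k \<noteq> 0" by auto
      ultimately show "g k = 0"
        using k by (auto simp: g_def b_def coeff_vec_def)
    qed
  qed auto
  also have "\<dots> = (\<Sum>n<N. g (2 * n))"
    by (subst sum.reindex) (auto simp: inj_on_def)
  also have "{..<N} = insert 0 {1..N - 1}"
    using m by auto
  also have "(\<Sum>n\<in>insert 0 {1..N - 1}. g (2 * n)) = g 0 + (\<Sum>n = 1..N - 1. g (2 * n))"
    by simp
  also have "g 0 = 2 / (pi + lam * what 0)"
    using m by (simp add: g_def b_def coeff_vec_def dct_gamma_def)
  also have "(\<Sum>n = 1..N - 1. g (2 * n))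
      = (\<Sum>n = 1..N - 1. cos (2 * (real n * t)) / (pi / 2 + lam * what n))"
    using m
    by (intro sum.cong) (auto simp: g_def b_def coeff_vec_def dct_gamma_def mult_ac)
  finally show ?thesis
    unfolding gam t_def b_def by simp
qed

section \<open>The diagonal of the hat matrix\<close>

theorem theorem4p2:
  fixes N :: nat and lam :: real and what w :: "nat \<Rightarrow> real"
    and x :: "nat \<Rightarrow> real" and F W What H :: "real mat"
  assumes N: "N \<ge> 1"
    and lam: "lam > 0"
    and what: "\<And>n. n < N \<Longrightarrow> what n > 0"
    and x: "\<And>m. m < N \<Longrightarrow> x m = cheb_node N m"
    and w: "\<And>m. m < N \<Longrightarrow> w m = pi / real N"
    and F: "F = cheb_fourier_mat N x N"
    and W: "W = mat_diag N w"
    and What: "What = mat_diag N what"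
    and H: "H = hat_matrix F W lam What"
    and m: "m < N"
  shows "H $$ (m, m) =
    w m / 2 *
      (sqrt (real N) / dct_gamma (2 * N) (2 * m + 1)
          * (dct1 (2 * N) *\<^sub>v coeff_vec N lam what) $ (2 * m + 1)
        + (\<Sum>n = 1..N - 1. 1 / (pi / 2 + lam * what n)))"
proof -
  define t where "t = (2 * real m + 1) * pi / (2 * real N)"
  define d where "d n = (if n = 0 then pi else pi / 2) + lam * what n" for n
  have d: "d n \<noteq> 0" if "n < N" for n
  proof -
    have "lam * what n > 0" using lam what[OF that] by simp
    then have "d n > 0" unfolding d_def by (intro add_pos_pos) auto
    then show ?thesis by simp
  qed
  have Fc: "F \<in> carrier_mat N N"
    by (simp add: F cheb_fourier_mat_def)
  have normal: "mat_adjoint F * mat_diag N w * F + lam \<cdot>\<^sub>m What = mat_diag N d"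
    unfolding F What d_def using x w by (rule cheb_normal_matrix)
  have "H $$ (m, m) = w m * (\<Sum>n<N. F $$ (m, n) * conjugate (F $$ (m, n)) / d n)"
    unfolding H W using Fc normal d m by (rule hat_matrix_diagonal_entry)
  also have "(\<Sum>n<N. F $$ (m, n) * conjugate (F $$ (m, n)) / d n)
      = (\<Sum>n<N. (cos (real n * t))\<^sup>2 / d n)"
    using m
    by (intro sum.cong)
      (auto simp: F cheb_fourier_mat_def x cheb_T_cheb_node t_def power2_eq_square)
  also have "{..<N} = insert 0 {1..N - 1}"
    using N by auto
  also have "(\<Sum>n\<in>insert 0 {1..N - 1}. (cos (real n * t))\<^sup>2 / d n)
      = 1 / d 0 + (\<Sum>n = 1..N - 1. (cos (real n * t))\<^sup>2 / d n)"
    by simp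
  also have "(\<Sum>n = 1..N - 1. (cos (real n * t))\<^sup>2 / d n)
      = (\<Sum>n = 1..N - 1. (cos (2 * (real n * t)) / (pi / 2 + lam * what n)
          + 1 / (pi / 2 + lam * what n)) / 2)"
  proof (rule sum.cong)
    fix n assume n: "n \<in> {1..N - 1}"
    have "(cos (real n * t))\<^sup>2 = (cos (2 * (real n * t)) + 1) / 2"
      by (simp only: cos_double_cos) simp
    then show "(cos (real n * t))\<^sup>2 / d n
        = (cos (2 * (real n * t)) / (pi / 2 + lam * what n) + 1 / (pi / 2 + lam * what n)) / 2"
      using n by (simp add: d_def add_divide_distrib mult_ac)
  qed simp
  also have "\<dots> = ((\<Sum>n = 1..N - 1. cos (2 * (real n * t)) / (pi / 2 + lam * what n))
      + (\<Sum>n = 1..N - 1. 1 / (pi / 2 + lam * what n))) / 2"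
    by (simp only: sum_divide_distrib[symmetric] sum.distrib)
  finally show ?thesis
    unfolding dct1_coeff_vec_odd[OF m] t_def[symmetric] by (simp add: d_def algebra_simps)
qed

end
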